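(* Let $k\ge1$ be an integer and $\ell$ a prime with $\gcd(\ell,2k)=1$. Assume hypotheses (H1$'$) and (H3$'$) stated in the context. Then for every $r\in\mathbb{Z}/\ell\mathbb{Z}$, $$F_N(r;k,\ell)=\frac{\pi_{\mathrm{perm}}(r;k,\ell)}{\ell-1}+O_{k,\ell}\bigl(N^{-1/2}\bigr)\qquad(N\to\infty).$$
   Context: Let $E_k=\{\varepsilon\in\{\pm1\}:\gcd(\varepsilon,2k)=1\}=\{-1,+1\}$. The canonical triple of a prime $p>k+1$ (when $p$ is representable) is the triple $(m,\varepsilon,q)$ with $m\ge1$, $\varepsilon\in E_k$, $q\in\mathbb{Z}$, $p=km(m+1)+\varepsilon+2kq$ and $|q|$ minimal (ties between $q$ and $-q$ resolved in favour of $q>0$); one writes $q_{\min}(k,m,\varepsilon):=q$. Let $p_1,p_2,\dots$ be the family primes, with canonical triples having first entries $(m_n,\varepsilon_n)$ and offsets $q_{\min}(k,m_n,\varepsilon_n)$, ordered by $m$, then $\varepsilon$, then $|q|$. Define $$F_N(r;k,\ell):=\frac1N\#\{n\le N: q_{\min}(k,m_n,\varepsilon_n)\equiv r\pmod\ell\}.$$ For $m_0\in\mathbb{Z}/\ell\mathbb{Z}$ and $\varepsilon\in E_k$ let $q^{*}=q^{*}(k,m_0,\varepsilon;\ell)\in\mathbb{Z}/\ell\mathbb{Z}$ be the class $-[km_0(m_0+1)+\varepsilon]\,(2k)^{-1}\bmod\ell$ (the forbidden residue), and define $$\pi_{\mathrm{perm}}(r;k,\ell):=\frac{1}{\ell|E_k|}\sum_{(m_0,\varepsilon)\in\mathbb{Z}/\ell\mathbb{Z}\times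 E_k}\mathbf 1[\,r\ne q^{*}(k,m_0,\varepsilon;\ell)\,].$$ (H1$'$) (equidistribution of strata) For all $(m_0,\varepsilon)$, $\nu_N(m_0,\varepsilon):=\frac1N\#\{n\le N:m_n\equiv m_0 \ (\mathrm{mod}\ \ell),\ \varepsilon_n=\varepsilon\}=\frac1{\ell|E_k|}+O_{k,\ell}(N^{-1/2})$. (H3$'$) (conditional uniformity on permitted residues) Conditional on $m_n\equiv m_0\pmod\ell$ and $\varepsilon_n=\varepsilon$, the residue $q_{\min}\bmod\ell$ is uniform on the $\ell-1$ permitted residues $r\ne q^{*}(k,m_0,\varepsilon;\ell)$; i.e. the proportion of $n\le N$ with $m_n\equiv m_0$, $\varepsilon_n=\varepsilon$ and $q_{\min}(k,m_n,\varepsilon_n)\equiv r$ equals $\nu_N(m_0,\varepsilon)\,\mathbf 1[r\ne q^{*}]/(\ell-1)$. *)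

theory Defs
  imports Complex_Main "HOL-Number_Theory.Number_Theory" "HOL-Number_Theory.Modular_Inverse"
    "HOL-Library.Landau_Symbols"
begin

text \<open>
  Classes in Z/lZ are handled through integer representatives: equality of classes is congruence
  modulo l, and sums over Z/lZ run over the representatives 0, ..., l - 1.
\<close>

definition unit_signs :: "int \<Rightarrow> int set" where
  "unit_signs k = {\<epsilon> \<in> {-1, 1}. gcd \<epsilon> (2 * k) = 1}"

definition represents :: "int \<Rightarrow> int \<Rightarrow> int \<times> int \<times> int \<Rightarrow> bool" where
  "represents k p = (\<lambda>(m, \<epsilon>, q).
     m \<ge> 1 \<and> \<epsilon> \<in> unit_signs k \<and> p = k * m * (m + 1) + \<epsilon> + 2 * k * q)"

text \<open>The minimum of \<open>\<bar>q\<bar>\<close> is over all representations of p, with m and the sign varying.\<close>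

definition is_canonical :: "int \<Rightarrow> int \<Rightarrow> int \<times> int \<times> int \<Rightarrow> bool" where
  "is_canonical k p = (\<lambda>(m, \<epsilon>, q). represents k p (m, \<epsilon>, q) \<and>
     (\<forall>m' \<epsilon>' q'. represents k p (m', \<epsilon>', q') \<longrightarrow>
        \<bar>q\<bar> \<le> \<bar>q'\<bar> \<and> (\<bar>q'\<bar> = \<bar>q\<bar> \<longrightarrow> q' \<le> q)))"

definition canonical_triple :: "int \<Rightarrow> int \<Rightarrow> int \<times> int \<times> int" where
  "canonical_triple k p = (THE t. is_canonical k p t)"

definition can_m :: "int \<Rightarrow> int \<Rightarrow> int" where
  "can_m k p = fst (canonical_triple k p)"

definition can_eps :: "int \<Rightarrow> int \<Rightarrow> int" where
  "can_eps k p = fst (snd (canonical_triple k p))"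

definition q_min :: "int \<Rightarrow> int \<Rightarrow> int" where
  "q_min k p = snd (snd (canonical_triple k p))"

text \<open>The triple is unique: equal q and different (m, sign) would force
  \<open>k * (m * (m + 1) - m' * (m' + 1))\<close> to be 2 or -2, which is impossible for
  \<open>m, m' \<ge> 1\<close>.\<close>

lemma represents_same_q:
  assumes k: "k \<ge> 1" and 1: "represents k p (m, \<epsilon>, q)" and 2: "represents k p (m', \<epsilon>', q)"
  shows "m = m' \<and> \<epsilon> = \<epsilon>'"
proof -
  have aux: "m1 \<ge> m2" if "represents k p (m1, e1, q)" "represents k p (m2, e2, q)" for m1 m2 e1 e2
  proof (rule ccontr)
    assume "\<not> m1 \<ge> m2"
    hence lt: "m2 \<ge> m1 + 1" by simp
    have m: "m1 \<ge> 1" using that by (simp add: represents_def)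
    have "(m1 + 1) * (m1 + 2) \<le> m2 * (m2 + 1)"
      using lt m by (intro mult_mono) auto
    hence "m2 * (m2 + 1) - m1 * (m1 + 1) \<ge> 4"
      using m by (simp add: algebra_simps)
    hence "k * (m2 * (m2 + 1) - m1 * (m1 + 1)) \<ge> 1 * 4"
      using k by (intro mult_mono) auto
    moreover have "k * (m2 * (m2 + 1) - m1 * (m1 + 1)) = e1 - e2"
      using that by (simp add: represents_def algebra_simps)
    moreover have "e1 - e2 \<le> 2"
      using that by (auto simp: represents_def unit_signs_def)
    ultimately show False by simp
  qed
  have "m = m'" using aux[OF 1 2] aux[OF 2 1] by simp
  thus ?thesis using 1 2 by (auto simp: represents_def)
qed

lemma ex1_canonical:
  assumes k: "k \<ge> 1" and ex: "\<exists>t. represents k p t"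
  shows "\<exists>!t. is_canonical k p t"
proof -
  define Q where "Q = {q. \<exists>m \<epsilon>. represents k p (m, \<epsilon>, q)}"
  obtain q0 where "q0 \<in> Q" using ex by (auto simp: Q_def)
  then obtain q1 where q1: "q1 \<in> Q" "\<And>q. q \<in> Q \<Longrightarrow> nat \<bar>q1\<bar> \<le> nat \<bar>q\<bar>"
    using ex_has_least_nat[of "\<lambda>q. q \<in> Q" q0 "\<lambda>q. nat \<bar>q\<bar>"] by blast
  define q where "q = (if \<bar>q1\<bar> \<in> Q then \<bar>q1\<bar> else q1)"
  have qQ: "q \<in> Q" using q1 by (simp add: q_def)
  have qmin: "\<bar>q\<bar> \<le> \<bar>q'\<bar> \<and> (\<bar>q'\<bar> = \<bar>q\<bar> \<longrightarrow> q' \<le> q)" if "q' \<in> Q" for q'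
    using q1(2)[OF that] that q1(1) by (auto simp: q_def abs_if split: if_splits)
  obtain m \<epsilon> where r: "represents k p (m, \<epsilon>, q)" using qQ by (auto simp: Q_def)
  show ?thesis
  proof (rule ex1I[of _ "(m, \<epsilon>, q)"])
    show c: "is_canonical k p (m, \<epsilon>, q)"
      using r qmin by (auto simp: is_canonical_def Q_def)
    fix t assume t: "is_canonical k p t"
    obtain m' e' q' where t_eq: "t = (m', e', q')" by (cases t)
    have r': "represents k p (m', e', q')"
      using t by (simp add: t_eq is_canonical_def)
    have "q' = q"
      using c t r r' unfolding t_eq is_canonical_def by (smt (verit) case_prod_conv)
    thus "t = (m, \<epsilon>, q)"
      using represents_same_q[OF k r] r' by (auto simp: t_eq)
  qed
qed

definition family_primes :: "int \<Rightarrow> int set" where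
  "family_primes k = {p. prime p \<and> p > k + 1 \<and> (\<exists>t. represents k p t)}"

text \<open>
  \<open>p 1, p 2, \<dots>\<close> enumerates the family primes in lexicographic order of
  \<open>(m, \<epsilon>, \<bar>q\<bar>)\<close>.  Two family primes can share this key (offsets q and -q); their relative
  order is left open.  The value \<open>p 0\<close> is irrelevant.
\<close>

definition family_enumeration :: "int \<Rightarrow> (nat \<Rightarrow> int) \<Rightarrow> bool" where
  "family_enumeration k p \<longleftrightarrow>
     bij_betw p {1..} (family_primes k) \<and>
     (\<forall>i\<ge>1. \<forall>j\<ge>i.
        can_m k (p i) < can_m k (p j) \<or>
        can_m k (p i) = can_m k (p j) \<and>
          (can_eps k (p i) < can_eps k (p j) \<or>
           can_eps k (p i) = can_eps k (p j) \<and> \<bar>q_min k (p i)\<bar> \<le> \<bar>q_min k (p j)\<bar>))"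

definition freq :: "int \<Rightarrow> int \<Rightarrow> (nat \<Rightarrow> int) \<Rightarrow> int \<Rightarrow> nat \<Rightarrow> real" where
  "freq k l p r N = real (card {n \<in> {1..N}. [q_min k (p n) = r] (mod l)}) / real N"

definition q_forbidden :: "int \<Rightarrow> int \<Rightarrow> int \<Rightarrow> int \<Rightarrow> int" where
  "q_forbidden k l m0 \<epsilon> = (- (k * m0 * (m0 + 1) + \<epsilon>) * modular_inverse l (2 * k)) mod l"

definition pi_perm :: "int \<Rightarrow> int \<Rightarrow> int \<Rightarrow> real" where
  "pi_perm k l r =
     1 / (real_of_int l * real (card (unit_signs k))) *
     (\<Sum>(m0, \<epsilon>) \<in> {0..<l} \<times> unit_signs k. of_bool (\<not> [r = q_forbidden k l m0 \<epsilon>] (mod l)))"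

definition stratum_freq :: "int \<Rightarrow> int \<Rightarrow> (nat \<Rightarrow> int) \<Rightarrow> int \<Rightarrow> int \<Rightarrow> nat \<Rightarrow> real" where
  "stratum_freq k l p m0 \<epsilon> N =
     real (card {n \<in> {1..N}. [can_m k (p n) = m0] (mod l) \<and> can_eps k (p n) = \<epsilon>}) / real N"

definition stratum_residue_freq ::
    "int \<Rightarrow> int \<Rightarrow> (nat \<Rightarrow> int) \<Rightarrow> int \<Rightarrow> int \<Rightarrow> int \<Rightarrow> nat \<Rightarrow> real" where
  "stratum_residue_freq k l p m0 \<epsilon> r N =
     real (card {n \<in> {1..N}. [can_m k (p n) = m0] (mod l) \<and> can_eps k (p n) = \<epsilon> \<and>
                             [q_min k (p n) = r] (mod l)}) / real N"

definition H1 :: "int \<Rightarrow> int \<Rightarrow> (nat \<Rightarrow> int) \<Rightarrow> bool" where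
  "H1 k l p \<longleftrightarrow> (\<forall>m0. \<forall>\<epsilon>\<in>unit_signs k.
     (\<lambda>N. stratum_freq k l p m0 \<epsilon> N - 1 / (real_of_int l * real (card (unit_signs k))))
       \<in> O(\<lambda>N. real N powr (-1/2)))"

definition uniform_permitted_freq ::
    "int \<Rightarrow> int \<Rightarrow> (nat \<Rightarrow> int) \<Rightarrow> int \<Rightarrow> int \<Rightarrow> int \<Rightarrow> nat \<Rightarrow> real" where
  "uniform_permitted_freq k l p m0 \<epsilon> r N =
     stratum_freq k l p m0 \<epsilon> N * of_bool (\<not> [r = q_forbidden k l m0 \<epsilon>] (mod l)) /
     real_of_int (l - 1)"

definition H3_exact :: "int \<Rightarrow> int \<Rightarrow> (nat \<Rightarrow> int) \<Rightarrow> bool" where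
  "H3_exact k l p \<longleftrightarrow> (\<forall>m0. \<forall>\<epsilon>\<in>unit_signs k. \<forall>r. \<forall>N\<ge>1.
     stratum_residue_freq k l p m0 \<epsilon> r N = uniform_permitted_freq k l p m0 \<epsilon> r N)"

text \<open>
  Read literally, as equality of proportions for every N, the uniformity hypothesis cannot hold:
  the counts are integers (see \<open>not_H3_exact\<close> below).  The satisfiable reading
  allows the same error term as in the equidistribution of strata.
\<close>

definition H3_asymp :: "int \<Rightarrow> int \<Rightarrow> (nat \<Rightarrow> int) \<Rightarrow> bool" where
  "H3_asymp k l p \<longleftrightarrow> (\<forall>m0. \<forall>\<epsilon>\<in>unit_signs k. \<forall>r.
     (\<lambda>N. stratum_residue_freq k l p m0 \<epsilon> r N - uniform_permitted_freq k l p m0 \<epsilon> r N)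
       \<in> O(\<lambda>N. real N powr (-1/2)))"

lemma H3_exact_imp_asymp:
  assumes "H3_exact k l p"
  shows "H3_asymp k l p"
  unfolding H3_asymp_def
proof (intro allI ballI)
  fix m0 \<epsilon> r assume e: "\<epsilon> \<in> unit_signs k"
  have "eventually (\<lambda>N. stratum_residue_freq k l p m0 \<epsilon> r N -
      uniform_permitted_freq k l p m0 \<epsilon> r N = 0) at_top"
    using eventually_ge_at_top[of "1::nat"]
    by (rule eventually_mono) (use assms e in \<open>simp add: H3_exact_def\<close>)
  thus "(\<lambda>N. stratum_residue_freq k l p m0 \<epsilon> r N - uniform_permitted_freq k l p m0 \<epsilon> r N)
      \<in> O(\<lambda>N. real N powr (-1/2))"
    using landau_o.big.in_cong by fastforce
qed

lemma not_H3_exact: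
  assumes k: "k \<ge> 1" and l: "prime l" "gcd l (2 * k) = 1" and p: "family_enumeration k p"
  shows "\<not> H3_exact k l p"
proof
  assume H: "H3_exact k l p"
  have "l \<noteq> 2" using l(2) by auto
  hence l3: "l \<ge> 3" using prime_ge_2_int[OF l(1)] by linarith
  define P where "P = p 1"
  have "P \<in> family_primes k"
    using p by (auto simp: family_enumeration_def P_def bij_betw_def)
  hence "\<exists>t. represents k P t" by (simp add: family_primes_def)
  from theI'[OF ex1_canonical[OF k this]]
  have "is_canonical k P (canonical_triple k P)" by (simp add: canonical_triple_def)
  hence e: "can_eps k P \<in> unit_signs k"
    by (auto simp: is_canonical_def represents_def can_eps_def split: prod.splits)
  have [simp]: "{n. n = Suc 0 \<and> [can_m k (p n) = can_m k P] (mod l) \<and> can_eps k (p n) = can_eps k P}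
      = {1}"
    "{n. n = Suc 0 \<and> [can_m k (p n) = can_m k P] (mod l) \<and> can_eps k (p n) = can_eps k P \<and>
       [q_min k (p n) = q_min k P] (mod l)} = {1}"
    by (auto simp: P_def)
  have "stratum_residue_freq k l p (can_m k P) (can_eps k P) (q_min k P) 1 =
        uniform_permitted_freq k l p (can_m k P) (can_eps k P) (q_min k P) 1"
    using H e by (simp add: H3_exact_def)
  thus False
    using l3 by (auto simp: stratum_residue_freq_def uniform_permitted_freq_def
        stratum_freq_def of_bool_def field_simps split: if_splits)
qed

end

theory Submission
  imports Defs
begin

text \<open>
  The argument is the law of total probability over the strata
  \<open>(m mod l, \<epsilon>)\<close>, of which there are only finitely many, so that error terms may be added
  up.  Every family prime lies in exactly one stratum
  (\<open>freq_eq_sum_strata\<close>).  Within a stratum, uniformity says that the proportion with residue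
  \<open>r\<close> is the stratum proportion times \<open>1[r \<noteq> q*] / (l - 1)\<close>, and equidistribution
  replaces the stratum proportion by the constant \<open>1 / (l |E\<^sub>k|)\<close>.  The sum of the resulting
  constants is by definition \<open>pi_perm / (l - 1)\<close>.  Hence the difference
  to be estimated is exactly the sum, over the strata, of one uniformity error and one bounded
  multiple of an equidistribution error (\<open>freq_error_decomposition\<close>).
\<close>

lemma finite_unit_signs: "finite (unit_signs k)"
  by (simp add: unit_signs_def)

text \<open>
  Without this, a prime could have a sign outside the index set of the strata and be missed by
  the sum over them.
\<close>

lemma can_eps_family_primes:
  assumes k: "k \<ge> 1" and P: "P \<in> family_primes k"
  shows "can_eps k P \<in> unit_signs k"
proof -
  have "\<exists>t. represents k P t" using P by (simp add: family_primes_def)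
  from theI'[OF ex1_canonical[OF k this]]
  have "is_canonical k P (canonical_triple k P)" by (simp add: canonical_triple_def)
  thus ?thesis
    by (auto simp: is_canonical_def represents_def can_eps_def split: prod.splits)
qed

lemma freq_eq_sum_strata:
  assumes l: "l > 0" and eps: "\<forall>n\<ge>1. can_eps k (p n) \<in> unit_signs k"
  shows "freq k l p r N =
    (\<Sum>(m0, \<epsilon>) \<in> {0..<l} \<times> unit_signs k. stratum_residue_freq k l p m0 \<epsilon> r N)"
proof -
  define A where "A = {n \<in> {1..N}. [q_min k (p n) = r] (mod l)}"
  define g where "g = (\<lambda>n. (can_m k (p n) mod l, can_eps k (p n)))"
  have "g ` A \<subseteq> {0..<l} \<times> unit_signs k"
    using l eps by (auto simp: A_def g_def)
  hence "card A = (\<Sum>s \<in> {0..<l} \<times> unit_signs k. card {n \<in> A. g n = s})"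
    using sum.group[of A "{0..<l} \<times> unit_signs k" g "\<lambda>_. 1 :: nat"]
    by (simp add: A_def finite_unit_signs)
  also have "\<dots> = (\<Sum>(m0, \<epsilon>) \<in> {0..<l} \<times> unit_signs k.
      card {n \<in> {1..N}. [can_m k (p n) = m0] (mod l) \<and> can_eps k (p n) = \<epsilon> \<and>
                        [q_min k (p n) = r] (mod l)})"
    by (intro sum.cong) (auto simp: A_def g_def cong_def intro!: arg_cong[where f = card])
  finally show ?thesis
    by (simp add: freq_def stratum_residue_freq_def A_def case_prod_unfold sum_divide_distrib)
qed

text \<open>
  With \<open>c = 1[r \<noteq> q*] / (l - 1)\<close>, each term telescopes: the uniformity error is the
  residue proportion minus \<open>c\<close> times the stratum proportion, and \<open>c\<close> times the
  equidistribution error restores that product and subtracts the main term.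
\<close>

lemma freq_error_decomposition:
  assumes l: "l > 0" and eps: "\<forall>n\<ge>1. can_eps k (p n) \<in> unit_signs k"
  shows "freq k l p r N - pi_perm k l r / real_of_int (l - 1) =
    (\<Sum>(m0, \<epsilon>) \<in> {0..<l} \<times> unit_signs k.
       (stratum_residue_freq k l p m0 \<epsilon> r N - uniform_permitted_freq k l p m0 \<epsilon> r N) +
       of_bool (\<not> [r = q_forbidden k l m0 \<epsilon>] (mod l)) / real_of_int (l - 1) *
         (stratum_freq k l p m0 \<epsilon> N - 1 / (real_of_int l * real (card (unit_signs k)))))"
  unfolding freq_eq_sum_strata[OF l eps] pi_perm_def
    uniform_permitted_freq_def sum_distrib_left sum_divide_distrib sum_subtractf[symmetric] case_prod_unfold
  by (intro sum.cong) (auto simp: algebra_simps)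

lemma freq_asymptotics:
  assumes l: "l > 0" and eps: "\<forall>n\<ge>1. can_eps k (p n) \<in> unit_signs k"
    and H1: "H1 k l p" and H3: "H3_asymp k l p"
  shows "(\<lambda>N. freq k l p r N - pi_perm k l r / real_of_int (l - 1))
    \<in> O(\<lambda>N. real N powr (-1/2))"
  unfolding freq_error_decomposition[OF l eps]
proof (intro big_sum_in_bigo, clarify)
  fix m0 \<epsilon> assume \<epsilon>: "\<epsilon> \<in> unit_signs k"
  let ?c = "of_bool (\<not> [r = q_forbidden k l m0 \<epsilon>] (mod l)) / real_of_int (l - 1)"
  show "(\<lambda>N. (stratum_residue_freq k l p m0 \<epsilon> r N - uniform_permitted_freq k l p m0 \<epsilon> r N) +
      ?c * (stratum_freq k l p m0 \<epsilon> N - 1 / (real_of_int l * real (card (unit_signs k)))))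
    \<in> O(\<lambda>N. real N powr (-1/2))"
  proof (rule sum_in_bigo(1))
    show "(\<lambda>N. stratum_residue_freq k l p m0 \<epsilon> r N - uniform_permitted_freq k l p m0 \<epsilon> r N)
      \<in> O(\<lambda>N. real N powr (-1/2))"
      using H3 \<epsilon> by (simp add: H3_asymp_def)
    have "(\<lambda>N. stratum_freq k l p m0 \<epsilon> N - 1 / (real_of_int l * real (card (unit_signs k))))
      \<in> O(\<lambda>N. real N powr (-1/2))"
      using H1 \<epsilon> by (simp add: H1_def)
    (* In the first case c = 0; otherwise c is a nonzero constant factor. *)
    thus "(\<lambda>N. ?c * (stratum_freq k l p m0 \<epsilon> N -
        1 / (real_of_int l * real (card (unit_signs k))))) \<in> O(\<lambda>N. real N powr (-1/2))"
      by (cases "[r = q_forbidden k l m0 \<epsilon>] (mod l) \<or> l = 1") auto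
  qed
qed

theorem theorem4p12:
  fixes k l :: int and p :: "nat \<Rightarrow> int"
  assumes "k \<ge> 1" and "prime l" and "gcd l (2 * k) = 1"
    and "family_enumeration k p"
    and "H1 k l p"
  shows "(H3_exact k l p \<longrightarrow>
            (\<forall>r. (\<lambda>N. freq k l p r N - pi_perm k l r / real_of_int (l - 1))
                   \<in> O(\<lambda>N. real N powr (-1/2)))) \<and>
         (H3_asymp k l p \<longrightarrow>
            (\<forall>r. (\<lambda>N. freq k l p r N - pi_perm k l r / real_of_int (l - 1))
                   \<in> O(\<lambda>N. real N powr (-1/2))))"
proof -
  have l: "l > 0" using assms(2) by (rule prime_gt_0_int)
  have eps: "\<forall>n\<ge>1. can_eps k (p n) \<in> unit_signs k"
    using assms(4)
    by (intro allI impI can_eps_family_primes[OF assms(1)])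
       (auto simp: family_enumeration_def bij_betw_def)
  have "(\<lambda>N. freq k l p r N - pi_perm k l r / real_of_int (l - 1))
      \<in> O(\<lambda>N. real N powr (-1/2))" if "H3_asymp k l p" for r
    by (rule freq_asymptotics[OF l eps assms(5) that])
  thus ?thesis using H3_exact_imp_asymp by blast
qed

end
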